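(* Set $P_0(x)=Q_0(x)=S_0(x)=T_0(x)=1$. Then for every integer $n\geq 0$, $$Q_n(x)=(1+2nx)P_n(x)+x(1-x)P_n'(x),$$ $$P_{n+1}(x)=(1+nx)Q_n(x)+\tfrac{1}{2}x(1-x)Q_n'(x),$$ and $$T_n(x)=(1+2nx)S_n(x)+x(1-x)S_n'(x),$$ $$S_{n+1}(x)=(1+3x+4nx)T_n(x)+2x(1-x)T_n'(x).$$
   Context: For $n\ge 1$: let $\mathcal{C}_n$ be the set of permutations (rearrangements) of the multiset $\{1,1,2,2,\ldots,n,n\}$ and $\mathfrak{D}_n$ the set of permutations of the multiset $\{1,1,2,2,\ldots,n,n,n+1\}$. For a word $\sigma=\sigma_1\cdots\sigma_m$, $\mathrm{des}(\sigma)=\#\{i\in\{1,\ldots,m-1\}:\sigma_i>\sigma_{i+1}\}$. Define $P_n(x)=\sum_{\sigma\in\mathcal{C}_n}x^{\mathrm{des}(\sigma)}$ and $Q_n(x)=\sum_{\sigma\in\mathfrak{D}_n}x^{\mathrm{des}(\sigma)}$. Let $\mathcal{C}_n^{\pm}$ be the set of all distinct signed permutations of the multiset $\{1,1,2,2,\ldots,n,n\}$, i.e. all words $\pm\sigma_1\pm\sigma_2\cdots\pm\sigma_{2n}$ with $\sigma_1\cdots\sigma_{2n}\in\mathcal{C}_n$ and each sign chosen arbitrarily. Let $\mathfrak{D}_n^{\pm}$ be the set of signed permutations of the multiset $\{1,1,2,2,\ldots,n,n,n+1\}$ in which the entry $n+1$ has a positive sign. For a signed word $\sigma=\sigma_1\cdots\sigma_m$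 set $\sigma_0=0$ and $\mathrm{des}_B(\sigma)=\#\{i\in\{0,1,\ldots,m-1\}:\sigma_i>\sigma_{i+1}\}$. Define $S_n(x)=\sum_{\sigma\in\mathcal{C}_n^{\pm}}x^{\mathrm{des}_B(\sigma)}$ and $T_n(x)=\sum_{\sigma\in\mathfrak{D}_n^{\pm}}x^{\mathrm{des}_B(\sigma)}$. Primes denote derivatives with respect to $x$. *)

theory Defs
  imports
    "HOL-Combinatorics.Multiset_Permutations"
    "HOL-Computational_Algebra.Polynomial"
begin

definition C_words :: "nat \<Rightarrow> nat list set" where
  "C_words n = permutations_of_multiset (repeat_mset 2 (mset_set {1..n}))"

definition D_words :: "nat \<Rightarrow> nat list set" where
  "D_words n = permutations_of_multiset (add_mset (n + 1) (repeat_mset 2 (mset_set {1..n})))"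

text \<open>Positions in a list are counted from 0.\<close>

definition des :: "nat list \<Rightarrow> nat" where
  "des w = card {i. i + 1 < length w \<and> w ! i > w ! (i + 1)}"

text \<open>
  A signed word is a list of integers; its underlying unsigned word is obtained by taking
  absolute values. All letters are nonzero, so each letter has exactly two signed versions.
\<close>

definition unsigned_word :: "int list \<Rightarrow> nat list" where
  "unsigned_word w = map (\<lambda>a. nat \<bar>a\<bar>) w"

definition C_signed :: "nat \<Rightarrow> int list set" where
  "C_signed n = {w. unsigned_word w \<in> C_words n}"

definition D_signed :: "nat \<Rightarrow> int list set" where
  "D_signed n = {w. unsigned_word w \<in> D_words n \<and> - int (n + 1) \<notin> set w}"

text \<open>The letter 0 is put in front of the word, so that \<open>(0 # w) ! i\<close> is \<open>\<sigma>\<^sub>i\<close> with \<open>\<sigma>\<^sub>0 = 0\<close>.\<close>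

definition des_B :: "int list \<Rightarrow> nat" where
  "des_B w = card {i. i < length w \<and> (0 # w) ! i > (0 # w) ! (i + 1)}"

definition P :: "nat \<Rightarrow> real poly" where
  "P n = (\<Sum>w\<in>C_words n. monom 1 (des w))"

definition Q :: "nat \<Rightarrow> real poly" where
  "Q n = (\<Sum>w\<in>D_words n. monom 1 (des w))"

definition S :: "nat \<Rightarrow> real poly" where
  "S n = (\<Sum>w\<in>C_signed n. monom 1 (des_B w))"

definition T :: "nat \<Rightarrow> real poly" where
  "T n = (\<Sum>w\<in>D_signed n. monom 1 (des_B w))"

lemma finite_C_words: "finite (C_words n)"
  and finite_D_words: "finite (D_words n)"
  by (simp_all add: C_words_def D_words_def)

lemma finite_unsigned_word_vimage:
  assumes "finite A"
  shows "finite {w. unsigned_word w \<in> A}"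
proof -
  have "finite {w. unsigned_word w = v}" for v
  proof (rule finite_subset)
    show "{w. unsigned_word w = v} \<subseteq>
      {w. set w \<subseteq> (\<Union>a\<in>set v. {int a, - int a}) \<and> length w = length v}"
      by (force simp: unsigned_word_def)
    show "finite {w. set w \<subseteq> (\<Union>a\<in>set v. {int a, - int a}) \<and> length w = length v}"
      by (rule finite_lists_length_eq) auto
  qed
  moreover have "{w. unsigned_word w \<in> A} = (\<Union>v\<in>A. {w. unsigned_word w = v})"
    by auto
  ultimately show ?thesis
    using assms by simp
qed

lemma finite_C_signed: "finite (C_signed n)"
  by (simp add: C_signed_def finite_unsigned_word_vimage finite_C_words)

lemma finite_D_signed: "finite (D_signed n)"
  by (rule finite_subset[OF _ finite_unsigned_word_vimage[OF finite_D_words[of n]]])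
    (auto simp: D_signed_def)

text \<open>At \<open>n = 0\<close> the sums over words give the convention \<open>P\<^sub>0 = Q\<^sub>0 = S\<^sub>0 = T\<^sub>0 = 1\<close>.\<close>

lemma P_0: "P 0 = 1"
  by (simp add: P_def C_words_def des_def)

lemma Q_0: "Q 0 = 1"
  by (simp add: Q_def D_words_def des_def permutations_of_multiset_singleton)

lemma S_0: "S 0 = 1"
proof -
  have "C_signed 0 = {[]}"
    by (auto simp: C_signed_def C_words_def unsigned_word_def)
  then show ?thesis
    by (simp add: S_def des_B_def)
qed

lemma T_0: "T 0 = 1"
proof -
  have "D_signed 0 = {[1]}"
    by (auto simp: D_signed_def D_words_def unsigned_word_def)
  then show ?thesis
    by (simp add: T_def des_B_def cong: conj_cong)
qed

end

theory Submission
  imports Defs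
begin

text \<open>
  Put the letter \<open>0\<close> in front of every word, signed or not, and insert a letter of maximal
  absolute value \<open>M = n + 1\<close> into a word with \<open>k\<close> descents. Inserting \<open>M\<close> preserves the number of
  descents in the descent gaps, in the last gap and directly before another \<open>M\<close>; inserting \<open>-M\<close>
  preserves it in the descent gaps only; every other insertion adds one descent. Each word with
  \<open>c\<close> copies of the letter arises from \<open>c\<close> insertions, which gives the first three recurrences.

  For \<open>S\<^sub>n\<^sub>+\<^sub>1\<close>, insertion into \<open>\<DD>\<^sub>n\<^sup>\<plusminus>\<close> reaches the words containing \<open>M,M\<close> or
  \<open>M,-M\<close>. Those containing \<open>-M,-M\<close> are obtained from those containing \<open>M,M\<close> by flipping both
  signs, which adds one descent if the word ends in \<open>M\<close> and none otherwise; the words ending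
  in \<open>M\<close> are those of \<open>\<DD>\<^sub>n\<^sup>\<plusminus>\<close> followed by \<open>M\<close>.
\<close>

section \<open>Descents by recursion on the word\<close>

fun descents :: "'a::linorder list \<Rightarrow> nat" where
  "descents (a # b # w) = of_bool (a > b) + descents (b # w)"
| "descents _ = 0"

lemma card_descents:
  fixes w :: "'a::linorder list"
  shows "card {i. i + 1 < length w \<and> w ! i > w ! (i + 1)} = descents w"
proof (induction w rule: descents.induct)
  case (1 a b w)
  let ?D = "\<lambda>w :: 'a list. {i. i + 1 < length w \<and> w ! i > w ! (i + 1)}"
  have fin: "finite (?D w)" for w
    by (rule finite_subset[of _ "{..<length w}"]) auto
  \<comment> \<open>Position 0 is split off; the remaining descent positions are those of the tail,
    shifted by one.\<close>
  have "?D (a # b # w) = (if a > b then {0} else {}) \<union> Suc ` ?D (b # w)"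
  proof (rule set_eqI)
    fix i show "i \<in> ?D (a # b # w) \<longleftrightarrow> i \<in> (if a > b then {0} else {}) \<union> Suc ` ?D (b # w)"
      by (cases i) (auto simp: image_iff)
  qed
  then have "card (?D (a # b # w)) = card (if a > b then {0::nat} else {}) + card (Suc ` ?D (b # w))"
    using fin[of "b # w"] by (auto intro!: card_Un_disjoint)
  also have "card (Suc ` ?D (b # w)) = card (?D (b # w))"
    by (rule card_image) simp
  finally show ?case
    using 1 by simp
qed simp_all

text \<open>No natural number lies below 0, so the leading 0 creates no descent. It serves as the
  letter before the first gap, and signed and unsigned words then share the same insertion
  counts.\<close>

lemma des_conv_descents: "des w = descents (0 # w)"
  unfolding des_def card_descents by (cases w) auto

lemma des_B_conv_descents: "des_B w = descents (0 # w)"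
  unfolding des_B_def card_descents[symmetric] by simp

lemma descents_snoc_max:
  assumes "\<forall>b\<in>set w. b \<le> M"
  shows "descents (w @ [M]) = descents w"
  using assms by (induction w rule: descents.induct) auto

section \<open>Inserting one letter in every gap of a word\<close>

definition insert_at :: "nat \<Rightarrow> 'a \<Rightarrow> 'a list \<Rightarrow> 'a list" where
  "insert_at j a w = take j w @ a # drop j w"

text \<open>The three kinds of gaps that preserve the descents are disjoint, since a gap before
  \<open>M\<close> is neither a descent nor the last gap; this gives the first coefficient, and the
  other gaps give the second. \<open>f\<close> is arbitrary so that the induction can absorb the
  descent between the first two letters into it.\<close>

lemma sum_descents_insert_max:
  fixes M :: "'a::linorder" and f :: "nat \<Rightarrow> 'b::comm_ring_1"
  assumes "c \<le> M" "\<forall>b\<in>set w. b \<le> M"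
  shows "(\<Sum>j\<le>length w. f (descents (c # insert_at j M w))) =
    of_nat (descents (c # w) + 1 + count_list w M) * f (descents (c # w)) +
    (of_nat (length w) - of_nat (descents (c # w)) - of_nat (count_list w M))
      * f (descents (c # w) + 1)"
  using assms
proof (induction w arbitrary: c f)
  case Nil
  then show ?case by (auto simp: insert_at_def)
next
  case (Cons b w)
  let ?d = "of_bool (c > b) :: nat"
  \<comment> \<open>Gap 0 lies between \<open>c\<close> and \<open>b\<close>. Every other gap lies
    after \<open>b\<close>, so the comparison of \<open>c\<close> with \<open>b\<close> survives as
    the constant shift \<open>?d\<close>, and the induction hypothesis applies to \<open>f\<close>
    shifted by it.\<close>
  have "(\<Sum>j\<le>length (b # w). f (descents (c # insert_at j M (b # w)))) =
      f (descents (c # M # b # w)) + (\<Sum>j\<le>length w. f (?d + descents (b # insert_at j M w)))"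
    by (simp add: sum.atMost_Suc_shift insert_at_def del: sum.atMost_Suc)
  also have "(\<Sum>j\<le>length w. f (?d + descents (b # insert_at j M w))) =
      of_nat (descents (b # w) + 1 + count_list w M) * f (?d + descents (b # w)) +
      (of_nat (length w) - of_nat (descents (b # w)) - of_nat (count_list w M))
        * f (?d + (descents (b # w) + 1))"
    using Cons.prems by (intro Cons.IH[of b "\<lambda>i. f (?d + i)"]) auto
  finally show ?case
    using Cons.prems by (auto simp: algebra_simps)
qed

text \<open>A letter below all others ends a descent wherever it is inserted and never starts one.
  Only a former descent gap compensates for this; the last gap now counts among those that add a
  descent.\<close>

lemma sum_descents_insert_min:
  fixes m :: "'a::linorder" and f :: "nat \<Rightarrow> 'b::comm_ring_1"
  assumes "m < c" "\<forall>b\<in>set w. m < b"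
  shows "(\<Sum>j\<le>length w. f (descents (c # insert_at j m w))) =
    of_nat (descents (c # w)) * f (descents (c # w)) +
    (of_nat (length w) + 1 - of_nat (descents (c # w))) * f (descents (c # w) + 1)"
  using assms
proof (induction w arbitrary: c f)
  case Nil
  then show ?case by (auto simp: insert_at_def)
next
  case (Cons b w)
  let ?d = "of_bool (c > b) :: nat"
  have "(\<Sum>j\<le>length (b # w). f (descents (c # insert_at j m (b # w)))) =
      f (descents (c # m # b # w)) + (\<Sum>j\<le>length w. f (?d + descents (b # insert_at j m w)))"
    by (simp add: sum.atMost_Suc_shift insert_at_def del: sum.atMost_Suc)
  also have "(\<Sum>j\<le>length w. f (?d + descents (b # insert_at j m w))) =
      of_nat (descents (b # w)) * f (?d + descents (b # w)) +
      (of_nat (length w) + 1 - of_nat (descents (b # w))) * f (?d + (descents (b # w) + 1))"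
    using Cons.prems by (intro Cons.IH[of b "\<lambda>i. f (?d + i)"]) auto
  finally show ?case
    using Cons.prems by (auto simp: algebra_simps)
qed

text \<open>Double counting: a word of \<open>A\<close> with a chosen gap corresponds to a word of
  \<open>B\<close> with a marked occurrence of \<open>a\<close>. Words of \<open>B\<close> without
  \<open>a\<close> have weight 0 on the right.\<close>

lemma sum_insertions:
  fixes f :: "'a list \<Rightarrow> 'b::semiring_1"
  assumes fin: "finite A" "finite B"
    and iff: "\<And>u t. u @ a # t \<in> B \<longleftrightarrow> u @ t \<in> A"
  shows "(\<Sum>w\<in>A. \<Sum>j\<le>length w. f (insert_at j a w)) = (\<Sum>v\<in>B. of_nat (count_list v a) * f v)"
proof -
  let ?J = "\<lambda>v. {j. j < length v \<and> v ! j = a}"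
  have "(\<Sum>w\<in>A. \<Sum>j\<le>length w. f (insert_at j a w)) =
      (\<Sum>(w, j)\<in>(SIGMA w:A. {..length w}). f (insert_at j a w))"
    using fin by (intro sum.Sigma) auto
  also have "\<dots> = (\<Sum>(v, j)\<in>(SIGMA v:B. ?J v). f v)"
  \<comment> \<open>The inverse of the insertion deletes the letter at the marked position
    \<open>j\<close>.\<close>
  proof (rule sum.reindex_bij_witness
      [where i = "\<lambda>(v, j). (take j v @ drop (Suc j) v, j)" and j = "\<lambda>(w, j). (insert_at j a w, j)"])
    fix p assume "p \<in> (SIGMA w:A. {..length w})"
    then obtain w j where p: "p = (w, j)" "w \<in> A" "j \<le> length w" by auto
    then show "(case case p of (w, j) \<Rightarrow> (insert_at j a w, j) of
        (v, j) \<Rightarrow> (take j v @ drop (Suc j) v, j)) = p"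
      by (simp add: insert_at_def)
    show "(case p of (w, j) \<Rightarrow> (insert_at j a w, j)) \<in> (SIGMA v:B. ?J v)"
      using p by (auto simp: insert_at_def iff nth_append)
    show "(case case p of (w, j) \<Rightarrow> (insert_at j a w, j) of (v, j) \<Rightarrow> f v) =
        (case p of (w, j) \<Rightarrow> f (insert_at j a w))"
      using p by simp
  next
    fix p assume "p \<in> (SIGMA v:B. ?J v)"
    then obtain v j where p: "p = (v, j)" "v \<in> B" "j < length v" "v ! j = a" by auto
    then have v: "take j v @ a # drop (Suc j) v = v"
      using id_take_nth_drop[of j v] by simp
    with p show "(case case p of (v, j) \<Rightarrow> (take j v @ drop (Suc j) v, j) of
        (w, j) \<Rightarrow> (insert_at j a w, j)) = p"
      by (simp add: insert_at_def)
    show "(case p of (v, j) \<Rightarrow> (take j v @ drop (Suc j) v, j)) \<in> (SIGMA w:A. {..length w})"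
      using p v by (auto simp: iff[symmetric])
  qed
  also have "\<dots> = (\<Sum>v\<in>B. \<Sum>j\<in>?J v. f v)"
    using fin by (intro sum.Sigma[symmetric]) auto
  also have "\<dots> = (\<Sum>v\<in>B. of_nat (count_list v a) * f v)"
    by (simp add: count_list_eq_length_filter length_filter_conv_card eq_commute)
  finally show ?thesis .
qed

section \<open>From descent counts to derivatives\<close>

lemma pderiv_sum: "pderiv (\<Sum>w\<in>A. p w) = (\<Sum>w\<in>A. pderiv (p w))"
  by (induction A rule: infinite_finite_induct) (simp_all add: pderiv_add)

text \<open>The operator \<open>x d/dx\<close> multiplies \<open>x^k\<close> by \<open>k\<close>, so
  \<open>x (1 - x) d/dx\<close> sends \<open>x^k\<close> to \<open>k x^k - k x^(k+1)\<close>.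
  Insertion counts are affine in the number of descents and can be sorted into this form.\<close>

lemma sum_monom_weighted:
  fixes d :: "'a \<Rightarrow> nat" and \<alpha> \<beta> \<gamma> :: "'b::{comm_ring_1,semiring_no_zero_divisors}"
  shows "(\<Sum>w\<in>A. [:\<gamma>:] * (of_nat (d w) * monom 1 (d w) - of_nat (d w) * monom 1 (d w + 1))
      + [:\<alpha>:] * monom 1 (d w) + [:\<beta>:] * monom 1 (d w + 1)) =
    [:\<alpha>, \<beta>:] * (\<Sum>w\<in>A. monom 1 (d w))
      + smult \<gamma> ([:0, 1:] * [:1, -1:] * pderiv (\<Sum>w\<in>A. monom 1 (d w)))"
proof -
  let ?X = "[:0, 1:] :: 'b poly"
  have X: "?X * monom 1 k = monom 1 (k + 1)" for k
    by (simp add: monom_Suc)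
  have D: "?X * pderiv (monom 1 k) = of_nat k * monom 1 k" for k
    by (cases k) (simp_all add: pderiv_monom monom_Suc[symmetric] of_nat_poly smult_monom
        del: of_nat_Suc)
  have "[:\<alpha>, \<beta>:] * monom 1 k + [:\<gamma>:] * (?X * [:1, -1:] * pderiv (monom 1 k)) =
      [:\<gamma>:] * (of_nat k * monom 1 k - of_nat k * monom 1 (k + 1))
      + [:\<alpha>:] * monom 1 k + [:\<beta>:] * monom 1 (k + 1)" for k
  proof -
    have "[:\<alpha>, \<beta>:] = [:\<alpha>:] + [:\<beta>:] * ?X" "[:1, -1:] = 1 - ?X"
      by (simp_all add: one_pCons)
    then have "[:\<alpha>, \<beta>:] * monom 1 k + [:\<gamma>:] * (?X * [:1, -1:] * pderiv (monom 1 k)) =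
        [:\<alpha>:] * monom 1 k + [:\<beta>:] * (?X * monom 1 k)
        + [:\<gamma>:] * ((1 - ?X) * (?X * pderiv (monom 1 k)))"
      by (simp only: distrib_right mult.assoc mult.left_commute[of "1 - ?X"])
    also have "\<dots> = [:\<alpha>:] * monom 1 k + [:\<beta>:] * (?X * monom 1 k)
        + [:\<gamma>:] * (of_nat k * monom 1 k - of_nat k * (?X * monom 1 k))"
      unfolding D by (simp only: left_diff_distrib right_diff_distrib mult_1 mult.left_commute)
    finally show ?thesis
      unfolding X by (simp only: add_ac)
  qed
  then have "(\<Sum>w\<in>A. [:\<gamma>:] * (of_nat (d w) * monom 1 (d w) - of_nat (d w) * monom 1 (d w + 1))
      + [:\<alpha>:] * monom 1 (d w) + [:\<beta>:] * monom 1 (d w + 1)) =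
      (\<Sum>w\<in>A. [:\<alpha>, \<beta>:] * monom 1 (d w) + [:\<gamma>:] * (?X * [:1, -1:] * pderiv (monom 1 (d w))))"
    by (simp only:)
  also have "\<dots> = [:\<alpha>, \<beta>:] * (\<Sum>w\<in>A. monom 1 (d w))
      + [:\<gamma>:] * (?X * [:1, -1:] * pderiv (\<Sum>w\<in>A. monom 1 (d w)))"
    by (simp only: pderiv_sum sum_distrib_left sum.distrib)
  finally show ?thesis
    by simp
qed

section \<open>Unsigned words\<close>

lemma count_list_eq_count: "count_list w a = count (mset w) a"
  by (induction w) auto

text \<open>Exposes the multiset of \<open>D_words n\<close> below one more copy of
  \<open>Suc n\<close>, so that deleting a copy is cancellation of \<open>add_mset\<close>.\<close>

lemma mset_C_words_Suc:
  "repeat_mset 2 (mset_set {1..Suc n}) =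
    add_mset (Suc n) (add_mset (Suc n) (repeat_mset 2 (mset_set {1..n})))"
  by (simp add: atLeastAtMostSuc_conv numeral_2_eq_2)

lemma insert_D_words: "u @ Suc n # t \<in> D_words n \<longleftrightarrow> u @ t \<in> C_words n"
  by (simp add: C_words_def D_words_def permutations_of_multiset_def)

lemma insert_C_words: "u @ Suc n # t \<in> C_words (Suc n) \<longleftrightarrow> u @ t \<in> D_words n"
  unfolding C_words_def D_words_def permutations_of_multiset_def mem_Collect_eq mset_C_words_Suc
  by simp

lemma C_words_D:
  assumes "w \<in> C_words n"
  shows "length w = 2 * n" "set w = {1..n}" "count_list w (Suc n) = 0"
proof -
  from assms have m: "mset w = repeat_mset 2 (mset_set {1..n})"
    by (simp add: C_words_def permutations_of_multiset_def)
  from arg_cong[OF m, of size] show "length w = 2 * n" by simp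
  from arg_cong[OF m, of set_mset] show "set w = {1..n}"
    by (simp add: numeral_2_eq_2)
  then show "count_list w (Suc n) = 0" by simp
qed

lemma D_words_D:
  assumes "w \<in> D_words n"
  shows "length w = 2 * n + 1" "set w = {1..Suc n}" "count_list w (Suc n) = 1"
proof -
  from assms have m: "mset w = add_mset (Suc n) (repeat_mset 2 (mset_set {1..n}))"
    by (simp add: D_words_def permutations_of_multiset_def)
  from arg_cong[OF m, of size] show "length w = 2 * n + 1" by simp
  from arg_cong[OF m, of set_mset] show "set w = {1..Suc n}"
    by (simp add: numeral_2_eq_2 atLeastAtMostSuc_conv)
  show "count_list w (Suc n) = 1" unfolding count_list_eq_count m by simp
qed

lemma count_max_C_words:
  assumes "w \<in> C_words (Suc n)"
  shows "count_list w (Suc n) = 2"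
proof -
  from assms have m: "mset w = repeat_mset 2 (mset_set {1..Suc n})"
    by (simp add: C_words_def permutations_of_multiset_def)
  show ?thesis unfolding count_list_eq_count m by simp
qed

text \<open>Translates between the constants \<open>[:c:]\<close> of
  \<open>sum_monom_weighted\<close> and the numerals and \<open>of_nat\<close> terms of the
  insertion counts.\<close>

lemma const_poly_conv:
  "[:1:] = (1 :: real poly)" "[:2:] = (2 :: real poly)" "[:2 * real n:] = 2 * of_nat n"
  "[:3 + 4 * real n:] = 3 + 4 * of_nat n"
  by (simp_all add: of_nat_poly numeral_poly)

text \<open>Each word of \<open>D_words n\<close> arises from exactly one insertion. Of the
  \<open>2n + 1\<close> gaps of a word with \<open>k\<close> descents, \<open>k + 1\<close> preserve
  \<open>k\<close> and \<open>2n - k\<close> raise it.\<close>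

lemma Q_recurrence:
  "Q n = [:1, 2 * real n:] * P n + [:0, 1:] * [:1, -1:] * pderiv (P n)"
proof -
  have "Q n = (\<Sum>v\<in>D_words n. of_nat (count_list v (Suc n)) * monom 1 (descents (0 # v)))"
    by (simp add: Q_def des_conv_descents D_words_D)
  also have "\<dots> = (\<Sum>w\<in>C_words n. \<Sum>j\<le>length w. monom 1 (descents (0 # insert_at j (Suc n) w)))"
    by (intro sum_insertions[symmetric] finite_C_words finite_D_words insert_D_words)
  also have "\<dots> = (\<Sum>w\<in>C_words n. [:1:] * (of_nat (des w) * monom 1 (des w)
        - of_nat (des w) * monom 1 (des w + 1))
      + [:1:] * monom 1 (des w) + [:2 * real n:] * monom 1 (des w + 1))"
    unfolding const_poly_conv
    by (intro sum.cong refl, subst sum_descents_insert_max)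
      (auto simp: C_words_D des_conv_descents algebra_simps)
  finally show ?thesis
    unfolding sum_monom_weighted P_def by simp
qed

text \<open>Each word is reached twice, once for each copy of the largest letter, whence the factor
  1/2. The copy already present adds one preserving gap: \<open>k + 2\<close> gaps preserve
  \<open>k\<close> and \<open>2n - k\<close> raise it.\<close>

lemma P_recurrence:
  "P (n + 1) = [:1, real n:] * Q n + smult (1 / 2) ([:0, 1:] * [:1, -1:] * pderiv (Q n))"
proof -
  have "[:2:] * P (n + 1) =
      (\<Sum>v\<in>C_words (Suc n). of_nat (count_list v (Suc n)) * monom 1 (descents (0 # v)))"
    by (simp add: P_def des_conv_descents count_max_C_words sum_distrib_left const_poly_conv)
  also have "\<dots> = (\<Sum>w\<in>D_words n. \<Sum>j\<le>length w. monom 1 (descents (0 # insert_at j (Suc n) w)))"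
    by (intro sum_insertions[symmetric] finite_C_words finite_D_words insert_C_words)
  also have "\<dots> = (\<Sum>w\<in>D_words n. [:1:] * (of_nat (des w) * monom 1 (des w)
        - of_nat (des w) * monom 1 (des w + 1))
      + [:2:] * monom 1 (des w) + [:2 * real n:] * monom 1 (des w + 1))"
    unfolding const_poly_conv
    by (intro sum.cong refl, subst sum_descents_insert_max)
      (auto simp: D_words_D des_conv_descents algebra_simps)
  finally have "[:2:] * P (n + 1) =
      [:2, 2 * real n:] * Q n + [:0, 1:] * [:1, -1:] * pderiv (Q n)"
    unfolding sum_monom_weighted Q_def by simp
  then have "smult (1 / 2) ([:2:] * P (n + 1)) =
      smult (1 / 2) ([:2, 2 * real n:] * Q n + [:0, 1:] * [:1, -1:] * pderiv (Q n))"
    by simp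
  then show ?thesis
    by (simp add: smult_add_right)
qed

section \<open>Signed words\<close>

lemma nat_abs_eq_Suc: "nat \<bar>a\<bar> = Suc n \<longleftrightarrow> a = int (Suc n) \<or> a = - int (Suc n)"
  by auto

lemma count_unsigned_word:
  "count_list (unsigned_word w) (Suc n) =
    count_list w (int (Suc n)) + count_list w (- int (Suc n))"
  by (induction w) (auto simp: unsigned_word_def nat_abs_eq_Suc)

lemma set_unsigned_wordD:
  assumes "set (unsigned_word w) = {1..m}" "a \<in> set w"
  shows "- int m \<le> a" "a \<le> int m"
proof -
  have "nat \<bar>a\<bar> \<in> set (unsigned_word w)"
    using assms(2) by (auto simp: unsigned_word_def)
  then show "- int m \<le> a" "a \<le> int m"
    using assms(1) by auto
qed

lemma C_signed_D:
  assumes "w \<in> C_signed n"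
  shows "length w = 2 * n" "\<And>a. a \<in> set w \<Longrightarrow> - int n \<le> a \<and> a \<le> int n"
    "count_list w (int (Suc n)) = 0" "- int (Suc n) \<notin> set w"
proof -
  have w: "unsigned_word w \<in> C_words n"
    using assms by (simp add: C_signed_def)
  then show "length w = 2 * n"
    using C_words_D(1)[OF w] by (simp add: unsigned_word_def)
  show bounds: "- int n \<le> a \<and> a \<le> int n" if "a \<in> set w" for a
    using set_unsigned_wordD[OF C_words_D(2)[OF w] that] by simp
  show "count_list w (int (Suc n)) = 0" "- int (Suc n) \<notin> set w"
    using bounds by (fastforce simp: count_list_0_iff)+
qed

lemma D_signed_D:
  assumes "w \<in> D_signed n"
  shows "length w = 2 * n + 1" "\<And>a. a \<in> set w \<Longrightarrow> - int (Suc n) < a \<and> a \<le> int (Suc n)"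
    "count_list w (int (Suc n)) = 1"
proof -
  have w: "unsigned_word w \<in> D_words n" and neg: "- int (Suc n) \<notin> set w"
    using assms by (simp_all add: D_signed_def)
  then show "length w = 2 * n + 1"
    using D_words_D(1)[OF w] by (simp add: unsigned_word_def)
  show "- int (Suc n) < a \<and> a \<le> int (Suc n)" if "a \<in> set w" for a
    using set_unsigned_wordD[OF D_words_D(2)[OF w] that] neg that by (metis order_le_less)
  show "count_list w (int (Suc n)) = 1"
    using D_words_D(3)[OF w] neg by (simp add: count_unsigned_word count_list_0_iff)
qed

text \<open>Words of \<open>C_signed n\<close> contain neither sign of \<open>Suc n\<close>, so
  after the insertion the only such letter is the positive one.\<close>

lemma insert_D_signed: "u @ int (Suc n) # t \<in> D_signed n \<longleftrightarrow> u @ t \<in> C_signed n"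
proof -
  have "unsigned_word (u @ int (Suc n) # t) \<in> D_words n \<longleftrightarrow> u @ t \<in> C_signed n"
    using insert_D_words[of "unsigned_word u" n "unsigned_word t"]
    by (simp add: C_signed_def unsigned_word_def del: of_nat_Suc)
  then show ?thesis
    using C_signed_D(4)[of "u @ t" n] by (auto simp: D_signed_def)
qed

lemma insert_C_signed:
  assumes "nat \<bar>a\<bar> = Suc n"
  shows "u @ a # t \<in> C_signed (Suc n) \<longleftrightarrow> unsigned_word (u @ t) \<in> D_words n"
  using insert_C_words[of "unsigned_word u" n "unsigned_word t"] assms
  by (simp add: C_signed_def unsigned_word_def)

text \<open>The gap count is the one for \<open>Q\<close>, now with the leading 0 taking part in
  descents.\<close>

lemma T_recurrence:
  "T n = [:1, 2 * real n:] * S n + [:0, 1:] * [:1, -1:] * pderiv (S n)"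
proof -
  have "T n = (\<Sum>v\<in>D_signed n. of_nat (count_list v (int (Suc n))) * monom 1 (descents (0 # v)))"
    by (simp add: T_def des_B_conv_descents D_signed_D(3)[unfolded One_nat_def[symmetric]] del: of_nat_Suc One_nat_def)
  also have "\<dots> = (\<Sum>w\<in>C_signed n. \<Sum>j\<le>length w.
      monom 1 (descents (0 # insert_at j (int (Suc n)) w)))"
    by (intro sum_insertions[symmetric] finite_C_signed finite_D_signed insert_D_signed)
  also have "\<dots> = (\<Sum>w\<in>C_signed n. [:1:] * (of_nat (des_B w) * monom 1 (des_B w)
        - of_nat (des_B w) * monom 1 (des_B w + 1))
      + [:1:] * monom 1 (des_B w) + [:2 * real n:] * monom 1 (des_B w + 1))"
    unfolding const_poly_conv
  proof (intro sum.cong refl, subst sum_descents_insert_max)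
    fix w assume w: "w \<in> C_signed n"
    show "\<forall>b\<in>set w. b \<le> int (Suc n)"
      using C_signed_D(2)[OF w] by fastforce
  qed (auto simp: C_signed_D des_B_conv_descents algebra_simps
      of_nat_Suc[where 'a = "real poly"] simp del: of_nat_Suc)
  finally show ?thesis
    unfolding sum_monom_weighted S_def by simp
qed

section \<open>Flipping the sign of the largest letter, and the recurrence for
  \<open>S\<close>\<close>

definition flip_letter :: "int \<Rightarrow> int \<Rightarrow> int" where
  "flip_letter M a = (if \<bar>a\<bar> = M then - a else a)"

lemma flip_letter_flip_letter [simp]: "flip_letter M (flip_letter M a) = a"
  by (simp add: flip_letter_def)

lemma unsigned_word_flip: "unsigned_word (map (flip_letter M) w) = unsigned_word w"
  by (auto simp: unsigned_word_def flip_letter_def)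

text \<open>For neighbours \<open>c\<close>, \<open>b\<close> the flip changes the descent indicator
  by \<open>[b = M] - [c = M]\<close>. The sum of these changes telescopes to the two ends of the
  word; the additive form avoids subtraction of natural numbers.\<close>

lemma descents_flip:
  assumes "\<forall>a\<in>set (c # w). - M < a \<and> a \<le> M"
  shows "descents (map (flip_letter M) (c # w)) + of_bool (c = M) =
    descents (c # w) + of_bool (last (c # w) = M)"
  using assms
proof (induction w arbitrary: c)
  case (Cons b w)
  have "of_bool (flip_letter M c > flip_letter M b) + of_bool (c = M) =
      (of_bool (c > b) + of_bool (b = M) :: nat)"
    using Cons.prems by (auto simp: flip_letter_def abs_if)
  with Cons.IH[of b] Cons.prems show ?case
    by simp
qed simp

lemma S_recurrence:
  "S (n + 1) = [:1, 3 + 4 * real n:] * T n + smult 2 ([:0, 1:] * [:1, -1:] * pderiv (T n))"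
proof -
  define M where "M = int (Suc n)"
  define x :: "int list \<Rightarrow> real poly" where "x w = monom 1 (descents (0 # w))" for w
  \<comment> \<open>The names record the signs of the two copies of the largest letter: both
    positive, mixed, both negative.\<close>
  define PP where "PP = {v \<in> C_signed (Suc n). - M \<notin> set v}"
  define PN where "PN = {v \<in> C_signed (Suc n). M \<in> set v \<and> - M \<in> set v}"
  define NN where "NN = {v \<in> C_signed (Suc n). M \<notin> set v}"
  have M: "M > 0" "nat \<bar>M\<bar> = Suc n" "nat \<bar>- M\<bar> = Suc n"
    by (simp_all add: M_def)
  have fin: "finite PP" "finite PN" "finite NN"
    by (simp_all add: PP_def PN_def NN_def finite_C_signed)
  have count2: "count_list v M + count_list v (- M) = 2" if "v \<in> C_signed (Suc n)" for v
    using count_max_C_words[of "unsigned_word v" n] that count_unsigned_word[of v n]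
    by (simp add: C_signed_def M_def)
  have bounds: "- M < a \<and> a \<le> M" if "v \<in> PP" "a \<in> set v" for v a
    using that C_signed_D(2)[of v "Suc n" a] by (auto simp: PP_def M_def order_le_less)
  have D_signed_iff: "w \<in> D_signed n \<longleftrightarrow> unsigned_word w \<in> D_words n \<and> - M \<notin> set w" for w
    by (simp add: D_signed_def M_def)
  \<comment> \<open>With a single copy present, absence of \<open>- M\<close> is the same as
    presence of \<open>M\<close>. This second form fits the deletion of \<open>- M\<close> from a
    mixed word.\<close>
  have D_signed_iff': "w \<in> D_signed n \<longleftrightarrow> unsigned_word w \<in> D_words n \<and> M \<in> set w" for w
  proof (cases "unsigned_word w \<in> D_words n")
    case True
    then have "count_list w M + count_list w (- M) = 1"
      using D_words_D(3) count_unsigned_word[of w n] by (simp add: M_def)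
    then have "- M \<notin> set w \<longleftrightarrow> M \<in> set w"
      using count_list_0_iff[of w M] count_list_0_iff[of w "- M"] by linarith
    with True show ?thesis by (simp add: D_signed_iff)
  qed (simp add: D_signed_iff)
  have insert_PP: "u @ M # t \<in> PP \<longleftrightarrow> u @ t \<in> D_signed n" for u t
    using M insert_C_signed[OF M(2)] by (auto simp: PP_def D_signed_iff)
  have insert_PN: "u @ (- M) # t \<in> PN \<longleftrightarrow> u @ t \<in> D_signed n" for u t
    using M insert_C_signed[OF M(3)] by (auto simp: PN_def D_signed_iff')

  \<comment> \<open>Both copies of \<open>M\<close> can be the inserted one. The factor 2 is kept,
    since twice this sum is what the final total requires.\<close>
  have "of_nat 2 * sum x PP = (\<Sum>v\<in>PP. of_nat (count_list v M) * x v)"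
    unfolding sum_distrib_left
  proof (intro sum.cong refl)
    fix v assume "v \<in> PP"
    then have "count_list v M = 2"
      using count2[of v] by (simp add: PP_def count_list_0_iff)
    then show "of_nat 2 * x v = of_nat (count_list v M) * x v" by simp
  qed
  also have "\<dots> = (\<Sum>w\<in>D_signed n. \<Sum>j\<le>length w. x (insert_at j M w))"
    by (intro sum_insertions[symmetric] finite_D_signed fin insert_PP)
  finally have PP: "2 * sum x PP = (\<Sum>w\<in>D_signed n. \<Sum>j\<le>length w. x (insert_at j M w))"
    by simp

  have "sum x PN = (\<Sum>v\<in>PN. of_nat (count_list v (- M)) * x v)"
  proof (intro sum.cong refl)
    fix v assume "v \<in> PN"
    then have "count_list v M + count_list v (- M) = 2" "count_list v M \<noteq> 0" "count_list v (- M) \<noteq> 0"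
      using count2[of v] by (simp_all add: PN_def count_list_0_iff)
    then have "count_list v (- M) = 1" by linarith
    then show "x v = of_nat (count_list v (- M)) * x v" by simp
  qed
  also have "\<dots> = (\<Sum>w\<in>D_signed n. \<Sum>j\<le>length w. x (insert_at j (- M) w))"
    by (intro sum_insertions[symmetric] finite_D_signed fin insert_PN)
  finally have PN: "sum x PN = (\<Sum>w\<in>D_signed n. \<Sum>j\<le>length w. x (insert_at j (- M) w))" .

  have "sum x NN = (\<Sum>v\<in>PP. x (map (flip_letter M) v))"
  proof (rule sum.reindex_bij_witness[where i = "map (flip_letter M)" and j = "map (flip_letter M)"])
    have flip: "a \<in> set (map (flip_letter M) v) \<longleftrightarrow> flip_letter M a \<in> set v" for a v
      by (force simp: image_iff intro: rev_bexI)
    have "flip_letter M M = - M" "flip_letter M (- M) = M"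
      using M by (simp_all add: flip_letter_def)
    then show "map (flip_letter M) v \<in> PP" if "v \<in> NN" for v
      using that flip[of "- M" v] by (simp add: PP_def NN_def C_signed_def unsigned_word_flip)
    show "map (flip_letter M) v \<in> NN" if "v \<in> PP" for v
      using that flip[of M v] \<open>flip_letter M M = - M\<close>
      by (simp add: PP_def NN_def C_signed_def unsigned_word_flip)
  qed (simp_all add: comp_def)
  \<comment> \<open>The leading 0 differs from \<open>M\<close>, so only the last letter can change
    the number of descents.\<close>
  also have "\<dots> = (\<Sum>v\<in>PP. x v + (if last (0 # v) = M
      then monom 1 (descents (0 # v) + 1) - monom 1 (descents (0 # v)) else 0))"
  proof (intro sum.cong refl)
    fix v assume v: "v \<in> PP"
    have "\<forall>a\<in>set (0 # v). - M < a \<and> a \<le> M"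
      using bounds[OF v] M by auto
    from descents_flip[OF this] M
    have "descents (0 # map (flip_letter M) v) = descents (0 # v) + of_bool (last (0 # v) = M)"
      by (simp add: flip_letter_def)
    then show "x (map (flip_letter M) v) = x v + (if last (0 # v) = M
        then monom 1 (descents (0 # v) + 1) - monom 1 (descents (0 # v)) else 0)"
      by (simp add: x_def)
  qed
  also have "\<dots> = sum x PP + (\<Sum>v\<in>{v \<in> PP. last (0 # v) = M}.
      monom 1 (descents (0 # v) + 1) - monom 1 (descents (0 # v)))"
    using fin by (simp only: sum.distrib sum.inter_filter)
  \<comment> \<open>Dropping the final \<open>M\<close> leaves a word of \<open>D_signed n\<close>
    with the same number of descents, because a maximal last letter ends no descent.\<close>
  also have "(\<Sum>v\<in>{v \<in> PP. last (0 # v) = M}.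
      monom 1 (descents (0 # v) + 1) - monom 1 (descents (0 # v))) =
      (\<Sum>w\<in>D_signed n. monom 1 (des_B w + 1) - monom (1::real) (des_B w))"
  proof (rule sum.reindex_bij_witness[where i = "\<lambda>w. w @ [M]" and j = butlast])
    fix v assume v: "v \<in> {v \<in> PP. last (0 # v) = M}"
    then have "v \<noteq> []" "last v = M"
      using M by (auto split: if_splits)
    then show v': "butlast v @ [M] = v"
      by (metis append_butlast_last_id)
    with v show D: "butlast v \<in> D_signed n"
      using insert_PP[of "butlast v" "[]"] by simp
    have "\<forall>a\<in>set (0 # butlast v). a \<le> M"
      using D_signed_D(2)[OF D] M by (auto simp: M_def)
    from descents_snoc_max[OF this] v' have "des_B (butlast v) = descents (0 # v)"
      by (simp add: des_B_conv_descents)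
    then show "monom 1 (des_B (butlast v) + 1) - monom 1 (des_B (butlast v)) =
        monom 1 (descents (0 # v) + 1) - monom (1::real) (descents (0 # v))"
      by simp
  next
    fix w assume "w \<in> D_signed n"
    then show "w @ [M] \<in> {v \<in> PP. last (0 # v) = M}"
      using insert_PP[of w "[]"] by simp
  qed simp
  finally have NN: "sum x NN =
      sum x PP + (\<Sum>w\<in>D_signed n. monom 1 (des_B w + 1) - monom (1::real) (des_B w))" .

  have split: "C_signed (Suc n) = PP \<union> PN \<union> NN"
    by (auto simp: PP_def PN_def NN_def)
  have disj: "PP \<inter> PN = {}" "(PP \<union> PN) \<inter> NN = {}"
  proof -
    show "PP \<inter> PN = {}" by (auto simp: PP_def PN_def)
    have "v \<notin> NN" if "v \<in> PP" for v
      using that count2[of v] count_list_0_iff[of v M] count_list_0_iff[of v "- M"]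
      by (auto simp: PP_def NN_def)
    then show "(PP \<union> PN) \<inter> NN = {}"
      by (auto simp: PN_def NN_def)
  qed
  have "S (n + 1) = sum x (C_signed (Suc n))"
    by (simp add: S_def x_def des_B_conv_descents)
  also have "\<dots> = sum x PP + sum x PN + sum x NN"
    unfolding split using fin disj by (simp add: sum.union_disjoint)
  also have "\<dots> = 2 * sum x PP + sum x PN
      + (\<Sum>w\<in>D_signed n. monom 1 (des_B w + 1) - monom (1::real) (des_B w))"
    by (simp add: NN)
  also have "\<dots> = (\<Sum>w\<in>D_signed n.
      (\<Sum>j\<le>length w. x (insert_at j M w)) + (\<Sum>j\<le>length w. x (insert_at j (- M) w))
      + (monom 1 (des_B w + 1) - monom 1 (des_B w)))"
    by (simp only: PP PN sum.distrib)
  \<comment> \<open>For \<open>k\<close> descents the coefficient of \<open>x^k\<close> is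
    \<open>(k + 2) + k - 1 = 2k + 1\<close>, and that of \<open>x^(k+1)\<close> is
    \<open>(2n - k) + (2n + 2 - k) + 1 = 4n + 3 - 2k\<close>.\<close>
  also have "\<dots> = (\<Sum>w\<in>D_signed n. [:2:] * (of_nat (des_B w) * monom 1 (des_B w)
        - of_nat (des_B w) * monom 1 (des_B w + 1))
      + [:1:] * monom 1 (des_B w) + [:3 + 4 * real n:] * monom 1 (des_B w + 1))"
  proof (intro sum.cong refl)
    fix w assume w: "w \<in> D_signed n"
    let ?k = "des_B w"
    have "\<forall>a\<in>set w. - M < a \<and> a \<le> M"
      using D_signed_D(2)[OF w] by (simp add: M_def)
    moreover have "count_list w M = 1" "length w = 2 * n + 1"
      using D_signed_D(1,3)[OF w] by (simp_all add: M_def)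
    ultimately have
      "(\<Sum>j\<le>length w. x (insert_at j M w)) = of_nat (?k + 2) * monom 1 ?k
        + (of_nat (2 * n + 1) - of_nat ?k - 1) * monom 1 (?k + 1)"
      "(\<Sum>j\<le>length w. x (insert_at j (- M) w)) = of_nat ?k * monom 1 ?k
        + (of_nat (2 * n + 1) + 1 - of_nat ?k) * monom 1 (?k + 1)"
      using sum_descents_insert_max[of 0 M w "monom (1::real)"]
        sum_descents_insert_min[of "- M" 0 w "monom (1::real)"] M
      unfolding x_def des_B_conv_descents by simp_all
    then show "(\<Sum>j\<le>length w. x (insert_at j M w)) + (\<Sum>j\<le>length w. x (insert_at j (- M) w))
        + (monom 1 (?k + 1) - monom 1 ?k) =
      [:2:] * (of_nat ?k * monom 1 ?k - of_nat ?k * monom 1 (?k + 1))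
        + [:1:] * monom 1 ?k + [:3 + 4 * real n:] * monom 1 (?k + 1)"
      unfolding const_poly_conv by (simp add: algebra_simps)
  qed
  also have "\<dots> = [:1, 3 + 4 * real n:] * T n + smult 2 ([:0, 1:] * [:1, -1:] * pderiv (T n))"
    unfolding sum_monom_weighted T_def ..
  finally show ?thesis .
qed

theorem theorem4:
  fixes n :: nat
  shows "Q n = [:1, 2 * real n:] * P n + [:0, 1:] * [:1, -1:] * pderiv (P n) \<and>
         P (n + 1) = [:1, real n:] * Q n + smult (1 / 2) ([:0, 1:] * [:1, -1:] * pderiv (Q n)) \<and>
         T n = [:1, 2 * real n:] * S n + [:0, 1:] * [:1, -1:] * pderiv (S n) \<and>
         S (n + 1) = [:1, 3 + 4 * real n:] * T n + smult 2 ([:0, 1:] * [:1, -1:] * pderiv (T n))"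
  by (intro conjI Q_recurrence P_recurrence T_recurrence S_recurrence)

end
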